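(* Let $t_0\in\mathbb{R}$, let $p,q:[t_0,+\infty)\to\mathbb{C}$ be continuous functions, and consider the equation $$\phi''(t)+p(t)\phi'(t)+q(t)\phi(t)=0,\qquad t\ge t_0. \quad ( * )$$ Assume that $p$ is continuously differentiable, that $D(t):=2p'(t)+p(t)^2-4q(t)$ is real with $D(t)>0$ for all $t\ge t_0$, and that $D$ is continuously differentiable on $[t_0,+\infty)$. Assume moreover that there are constants $\varepsilon>0$, $c>0$, $\alpha>0$ such that $$D(t)\ge\varepsilon,\qquad \frac{|D'(t)|}{D(t)}\le\frac{c}{(1+t-t_0)^\alpha},\qquad t\ge t_0,$$ and $$\int_{t_0}^{+\infty}\frac{d\tau}{\sqrt{D(\tau)}\,(1+\tau-t_0)^{2\alpha}}<+\infty.$$ For $t\ge t_0$ let $$r_1(t):=\int_{t_0}^t\bigl[\sqrt{D(\tau)}-\operatorname{Re}p(\tau)\bigr]d\tau-\tfrac12\ln D(t),\qquad r_2(t):=r_1(t)+2\ln\bigl[1+|p(t)-\sqrt{D(t)}|\bigr].$$ Then the following assertions are valid. (A$_1$) All solutions of $( * )$ are bounded on $[t_0,+\infty)$ if and only if $r_1$ is bounded above; and all solutions of $( * )$ tend to $0$ as $t\to+\infty$ if and only if $\lim_{t\to+\infty}r_1(t)=-\infty$. (B$_1$) Equation $( * )$ is Liapunov stable if and only if $r_2$ is bounded above; and $( * )$ is asymptotically stable if and only if $\lim_{t\to+\infty}r_2(t)=-\infty$.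
   Context: Solutions of the equation are complex-valued functions on $[t_0,+\infty)$. The second order equation is called Liapunov stable (respectively asymptotically stable) if the zero solution of the equivalent linear first order system $\phi'=\psi$, $\psi'=-q(t)\phi-p(t)\psi$ (with complex-valued solutions $(\phi,\psi)=(\phi,\phi')$ on $[t_0,+\infty)$) is Liapunov stable (respectively asymptotically stable) as $t\to+\infty$. *)

theory Defs
  imports "HOL-Analysis.Analysis"
begin

definition ode_solution ::
  "(real \<Rightarrow> 'a \<Rightarrow> 'a::real_normed_vector) \<Rightarrow> real \<Rightarrow> (real \<Rightarrow> 'a) \<Rightarrow> bool"
  where "ode_solution f t0 x \<longleftrightarrow>
    (\<forall>t\<ge>t0. (x has_vector_derivative f t (x t)) (at t within {t0..}))"

text \<open>
  Stability of a solution \<open>x\<close> of \<open>x' = f(t, x)\<close> on the half-line from \<open>t0\<close>, with an arbitrary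
  initial time \<open>t1 \<ge> t0\<close>. Neighbouring solutions range over solutions on the whole half-line;
  for the linear systems considered here every local solution extends to such a one.
\<close>

definition liapunov_stable_solution ::
  "(real \<Rightarrow> 'a \<Rightarrow> 'a::real_normed_vector) \<Rightarrow> real \<Rightarrow> (real \<Rightarrow> 'a) \<Rightarrow> bool"
  where "liapunov_stable_solution f t0 x \<longleftrightarrow> ode_solution f t0 x \<and>
    (\<forall>t1\<ge>t0. \<forall>e>0. \<exists>d>0. \<forall>y. ode_solution f t0 y \<longrightarrow> norm (y t1 - x t1) < d \<longrightarrow>
      (\<forall>t\<ge>t1. norm (y t - x t) < e))"

definition asymptotically_stable_solution ::
  "(real \<Rightarrow> 'a \<Rightarrow> 'a::real_normed_vector) \<Rightarrow> real \<Rightarrow> (real \<Rightarrow> 'a) \<Rightarrow> bool"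
  where "asymptotically_stable_solution f t0 x \<longleftrightarrow> liapunov_stable_solution f t0 x \<and>
    (\<forall>t1\<ge>t0. \<exists>d>0. \<forall>y. ode_solution f t0 y \<longrightarrow> norm (y t1 - x t1) < d \<longrightarrow>
      ((\<lambda>t. y t - x t) \<longlongrightarrow> 0) at_top)"

definition second_order_solution ::
  "(real \<Rightarrow> complex) \<Rightarrow> (real \<Rightarrow> complex) \<Rightarrow> real \<Rightarrow> (real \<Rightarrow> complex) \<Rightarrow> bool"
  where "second_order_solution p q t0 \<phi> \<longleftrightarrow>
    (\<exists>\<phi>1 \<phi>2. \<forall>t\<ge>t0.
      (\<phi> has_vector_derivative \<phi>1 t) (at t within {t0..}) \<and>
      (\<phi>1 has_vector_derivative \<phi>2 t) (at t within {t0..}) \<and>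
      \<phi>2 t + p t * \<phi>1 t + q t * \<phi> t = 0)"

definition first_order_system ::
  "(real \<Rightarrow> complex) \<Rightarrow> (real \<Rightarrow> complex) \<Rightarrow> real \<Rightarrow> complex \<times> complex \<Rightarrow> complex \<times> complex"
  where "first_order_system p q t = (\<lambda>(\<phi>, \<psi>). (\<psi>, - q t * \<phi> - p t * \<psi>))"

definition liapunov_stable ::
  "(real \<Rightarrow> complex) \<Rightarrow> (real \<Rightarrow> complex) \<Rightarrow> real \<Rightarrow> bool"
  where "liapunov_stable p q t0 \<longleftrightarrow>
    liapunov_stable_solution (first_order_system p q) t0 (\<lambda>t. 0)"

definition asymptotically_stable ::
  "(real \<Rightarrow> complex) \<Rightarrow> (real \<Rightarrow> complex) \<Rightarrow> real \<Rightarrow> bool"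
  where "asymptotically_stable p q t0 \<longleftrightarrow>
    asymptotically_stable_solution (first_order_system p q) t0 (\<lambda>t. 0)"

definition r1 :: "real \<Rightarrow> (real \<Rightarrow> complex) \<Rightarrow> (real \<Rightarrow> real) \<Rightarrow> real \<Rightarrow> real"
  where "r1 t0 p D t = integral {t0..t} (\<lambda>\<tau>. sqrt (D \<tau>) - Re (p \<tau>)) - ln (D t) / 2"

definition r2 :: "real \<Rightarrow> (real \<Rightarrow> complex) \<Rightarrow> (real \<Rightarrow> real) \<Rightarrow> real \<Rightarrow> real"
  where "r2 t0 p D t = r1 t0 p D t + 2 * ln (1 + norm (p t - complex_of_real (sqrt (D t))))"

end

theory Submission
  imports Defs
begin

text \<open>
  Write \<open>P\<close> for the primitive of \<open>p\<close> vanishing at \<open>t0\<close> and substitute \<open>\<phi> = exp (- P / 2) * w\<close>. The equation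
  becomes \<open>w'' = s\<^sup>2 w\<close> with \<open>s = sqrt D / 2\<close>, a \<^emph>\<open>real\<close> equation with a positive coefficient, although \<open>p\<close>
  and \<open>q\<close> are complex. Let \<open>w\<close> be its solution with \<open>w = 1\<close>, \<open>w' = s\<close> at \<open>t0\<close>. It is positive and increasing, and
  reduction of order gives all solutions of the equation: with \<open>\<Phi> = exp (- P / 2) * w\<close> and
  \<open>I\<close> the primitive of \<open>1 / w\<^sup>2\<close>, they are \<open>\<Phi> * (a + b * I)\<close>. Since \<open>w' \<ge> s t0 > 0\<close>, the function \<open>I\<close> is bounded;
  hence \<open>\<Phi>\<close> dominates every solution and the pair \<open>(\<Phi>, \<Phi>')\<close> dominates every solution
  of the first order system (\<open>solutions_dominated\<close>). Boundedness, decay and both kinds of stability thus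
  become statements about the size of \<open>\<Phi>\<close> and of \<open>(\<Phi>, \<Phi>')\<close>.

  The size of \<open>w\<close> is found from its logarithmic derivative \<open>u = w' / w\<close>, which satisfies the Riccati equation
  \<open>u' = s\<^sup>2 - u\<^sup>2\<close>. The expected amplitude is the Liouville-Green one,
  \<open>w \<approx> exp (\<integral> s) / sqrt s\<close>. The usual error estimate uses \<open>s''\<close>, which need not exist here. It is replaced by
  the reflection coefficient \<open>\<theta> = (u - s) / (u + s)\<close>, which stays in \<open>[-1, 1]\<close> and satisfies
  \<open>\<theta>' = - 2 s \<theta> - (s' / (2 s)) (1 - \<theta>\<^sup>2)\<close>. The logarithm of \<open>sqrt s * w * exp (- \<integral> s) * (u + s) / s\<close> has derivative
  \<open>- (s' / (2 s)) \<theta>\<close>; the damping term \<open>- 2 s \<theta>\<close> in the equation for \<open>\<theta>\<close> allows the total variation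
  of this logarithm to be bounded by the integral of \<open>(s' / s)\<^sup>2 / s\<close>, and this is where the integrability
  hypothesis enters (\<open>log_amplitude\<close>). The bound on \<open>D' / D\<close> moreover keeps \<open>u - s\<close> bounded (\<open>u_near_s\<close>).
  Therefore \<open>ln \<bar>\<Phi>\<bar>\<close> differs from \<open>r1 / 2\<close> by a bounded quantity. As \<open>\<Phi>' / \<Phi> = u - p / 2\<close> is
  at bounded distance from \<open>(sqrt D - p) / 2\<close>, the logarithm of the norm of \<open>(\<Phi>, \<Phi>')\<close> differs
  from \<open>r2 / 2\<close> by a bounded quantity as well (\<open>log_norm_solution_pair\<close>).
\<close>

section \<open>Calculus on a half-line\<close>

lemma nonincreasing_halfline:
  fixes f :: "real \<Rightarrow> real"
  assumes der: "\<And>t. t \<ge> t0 \<Longrightarrow> (f has_real_derivative f' t) (at t within {t0..})"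
    and nonpos: "\<And>t. t \<ge> t0 \<Longrightarrow> f' t \<le> 0"
    and "t0 \<le> t1" "t1 \<le> t2"
  shows "f t2 \<le> f t1"
proof (cases "t1 = t2")
  case False
  with assms have "t1 < t2" by simp
  have "(f has_derivative (\<lambda>h. f' x * h)) (at x within {t1..t2})" if "t1 \<le> x" "x \<le> t2" for x
    using der[of x] that assms(3) has_derivative_subset[of f _ x "{t0..}" "{t1..t2}"]
    by (auto simp: has_field_derivative_def)
  from mvt_simple[OF \<open>t1 < t2\<close> this] obtain x where
    "x \<in> {t1<..<t2}" "f t2 - f t1 = f' x * (t2 - t1)" by auto
  moreover from this have "f' x * (t2 - t1) \<le> 0"
    using nonpos[of x] assms(3) by (intro mult_nonpos_nonneg) auto
  ultimately show ?thesis by simp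
qed auto

lemma nondecreasing_halfline:
  fixes f :: "real \<Rightarrow> real"
  assumes der: "\<And>t. t \<ge> t0 \<Longrightarrow> (f has_real_derivative f' t) (at t within {t0..})"
    and "\<And>t. t \<ge> t0 \<Longrightarrow> f' t \<ge> 0"
    and "t0 \<le> t1" "t1 \<le> t2"
  shows "f t1 \<le> f t2"
proof -
  have "- f t2 \<le> - f t1"
    by (rule nonincreasing_halfline[where f' = "\<lambda>t. - f' t" and ?t0.0 = t0])
       (use assms in \<open>auto intro: derivative_intros\<close>)
  then show ?thesis by simp
qed

lemma constant_halfline:
  fixes f :: "real \<Rightarrow> 'a::real_normed_vector"
  assumes "\<And>t. t \<ge> t0 \<Longrightarrow> (f has_vector_derivative 0) (at t within {t0..})"
    and "t \<ge> t0" "t1 \<ge> t0"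
  shows "f t = f t1"
proof -
  obtain a where "\<And>t. t \<in> {t0..} \<Longrightarrow> f t = a"
    using has_vector_derivative_zero_constant[of "{t0..}" f] assms(1) by auto
  with assms(2,3) show ?thesis by simp
qed

lemma integral_halfline_has_vector_derivative:
  fixes f :: "real \<Rightarrow> 'a::banach"
  assumes "continuous_on {t0..} f" "t0 \<le> t"
  shows "((\<lambda>t. integral {t0..t} f) has_vector_derivative f t) (at t within {t0..})"
proof -
  have "((\<lambda>t. integral {t0..t} f) has_vector_derivative f t) (at t within {t0..t+1})"
    by (rule integral_has_vector_derivative)
       (use assms in \<open>auto intro: continuous_on_subset\<close>)
  moreover have "at t within {t0..t+1} = at t within {t0..}"
    by (rule at_within_nhd[of _ "{..<t+1}"]) auto
  ultimately show ?thesis by simp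
qed

section \<open>Global solutions of linear differential equations\<close>

text \<open>
  A contraction argument that gives the solution on the whole half-line at once. The unknown is rescaled to
  \<open>u = exp (- K) x\<close> with \<open>K' = 2 \<parallel>A\<parallel>\<close>, where \<open>\<parallel>A\<parallel>\<close> is the operator norm; for the rescaled functions the integral
  operator of the equation has Lipschitz constant \<open>1/2\<close> in the supremum norm, however fast \<open>A\<close> grows.
\<close>
theorem linear_ode_solution_exists:
  fixes A :: "real \<Rightarrow> 'a::banach \<Rightarrow>\<^sub>L 'a"
  assumes A: "continuous_on {t0..} A"
  shows "\<exists>x. x t0 = x0 \<and> ode_solution (\<lambda>t. blinfun_apply (A t)) t0 x"
proof -
  define k where "k t = 2 * norm (A t)" for t
  define K where "K t = integral {t0..t} k" for t
  have k_cont: "continuous_on {t0..} k"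
    unfolding k_def by (intro continuous_intros A)
  have K_deriv: "(K has_real_derivative k t) (at t within {t0..})" if "t \<ge> t0" for t
    unfolding K_def has_real_derivative_iff_has_vector_derivative
    using integral_halfline_has_vector_derivative[OF k_cont that] .
  have K_cont: "continuous_on {t0..} K"
    by (rule DERIV_continuous_on[where D = k]) (use K_deriv in auto)
  define f where "f u \<tau> = exp (K \<tau>) *\<^sub>R A \<tau> (apply_bcontfun u \<tau>)" for u \<tau>
  have u_cont: "continuous_on S (apply_bcontfun u)" for u :: "real \<Rightarrow>\<^sub>C 'a" and S
    by (rule continuous_on_subset[of UNIV]) (auto intro: continuous_on_apply_bcontfun)
  have f_cont: "continuous_on {t0..} (f u)" for u
    unfolding f_def by (intro continuous_intros A K_cont u_cont)
  have f_int: "f u integrable_on {t0..t}" for u t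
    by (rule integrable_continuous_real, rule continuous_on_subset[OF f_cont]) auto
  have f_bound: "norm (integral {t0..t} (f u)) \<le> norm u / 2 * exp (K t)" if "t \<ge> t0" for u t
  proof -
    have E: "((\<lambda>\<tau>. norm u / 2 * (exp (K \<tau>) * k \<tau>)) has_integral
        norm u / 2 * exp (K t) - norm u / 2 * exp (K t0)) {t0..t}"
    proof (rule fundamental_theorem_of_calculus[OF that])
      fix \<tau> assume "\<tau> \<in> {t0..t}"
      then have "(K has_real_derivative k \<tau>) (at \<tau> within {t0..t})"
        using DERIV_subset[OF K_deriv[of \<tau>]] by auto
      then show "((\<lambda>\<tau>. norm u / 2 * exp (K \<tau>)) has_vector_derivative
          norm u / 2 * (exp (K \<tau>) * k \<tau>)) (at \<tau> within {t0..t})"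
        unfolding has_real_derivative_iff_has_vector_derivative[symmetric]
        by (auto intro!: derivative_eq_intros)
    qed
    have "norm (integral {t0..t} (f u)) \<le> norm u / 2 * exp (K t) - norm u / 2 * exp (K t0)"
    proof (rule Henstock_Kurzweil_Integration.integral_norm_bound_integral[THEN order_trans, OF f_int has_integral_integrable[OF E]])
      fix \<tau>
      have "norm (A \<tau> (apply_bcontfun u \<tau>)) \<le> norm (A \<tau>) * norm u"
        by (rule order_trans[OF norm_blinfun]) (intro mult_left_mono norm_bounded norm_ge_zero)
      then have "exp (K \<tau>) * norm (A \<tau> (apply_bcontfun u \<tau>)) \<le> exp (K \<tau>) * (norm (A \<tau>) * norm u)"
        by (intro mult_left_mono) auto
      then show "norm (f u \<tau>) \<le> norm u / 2 * (exp (K \<tau>) * k \<tau>)"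
        by (simp add: f_def k_def algebra_simps)
    qed (use E in \<open>simp add: has_integral_iff\<close>)
    also have "\<dots> \<le> norm u / 2 * exp (K t)" by simp
    finally show ?thesis .
  qed
  have f_diff: "integral {t0..t} (f u) - integral {t0..t} (f v) = integral {t0..t} (f (u - v))" for u v t
    unfolding integral_diff[OF f_int f_int, symmetric]
    by (rule Henstock_Kurzweil_Integration.integral_cong)
       (simp add: f_def minus_bcontfun.rep_eq blinfun.diff_right scaleR_diff_right)
  \<comment> \<open>Bounded continuous functions live on the whole line, so the images are continued as constants
      to the left of \<open>t0\<close>.\<close>
  define T where "T u t = exp (- K (max t0 t)) *\<^sub>R (x0 + integral {t0..max t0 t} (f u))" for u t
  have T_bcont: "T u \<in> bcontfun" for u
  proof (rule bcontfun_normI)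
    have "continuous_on {t0..} (\<lambda>t. integral {t0..t} (f u))"
      using integral_halfline_has_vector_derivative[OF f_cont]
      by (auto simp: continuous_on_eq_continuous_within intro: has_vector_derivative_continuous)
    then have "continuous_on {t0..} (\<lambda>t. exp (- K t) *\<^sub>R (x0 + integral {t0..t} (f u)))"
      by (intro continuous_intros K_cont)
    then show "continuous_on UNIV (T u)"
      unfolding T_def
      by (rule continuous_on_compose2[of "{t0..}" _ UNIV "\<lambda>t. max t0 t"])
         (auto intro!: continuous_intros)
    fix t
    let ?m = "max t0 t"
    have "K t0 \<le> K ?m"
      by (rule nondecreasing_halfline[OF K_deriv]) (auto simp: k_def)
    then have "exp (- K ?m) \<le> 1" by (simp add: K_def)
    then have "exp (- K ?m) * norm x0 \<le> norm x0"
      by (intro mult_left_le_one_le) auto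
    moreover have "exp (- K ?m) * norm (integral {t0..?m} (f u)) \<le> norm u / 2"
      using f_bound[of ?m u] by (simp add: exp_minus field_simps)
    moreover have "norm (T u t) \<le> exp (- K ?m) * (norm x0 + norm (integral {t0..?m} (f u)))"
      unfolding T_def norm_scaleR by (simp add: norm_triangle_ineq)
    ultimately show "norm (T u t) \<le> norm x0 + norm u / 2"
      by (simp add: algebra_simps)
  qed
  have "\<exists>!u. Bcontfun (T u) = u"
  proof (rule banach_fix_type[where c = "1/2"])
    show "\<forall>u v. dist (Bcontfun (T u)) (Bcontfun (T v)) \<le> 1/2 * dist u v"
    proof (intro allI dist_bound)
      fix u v :: "real \<Rightarrow>\<^sub>C 'a" and t
      let ?m = "max t0 t"
      have "T u t - T v t = exp (- K ?m) *\<^sub>R integral {t0..?m} (f (u - v))"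
        unfolding T_def f_diff[symmetric] by (simp add: algebra_simps)
      then have "dist (T u t) (T v t) = exp (- K ?m) * norm (integral {t0..?m} (f (u - v)))"
        by (simp add: dist_norm)
      also have "\<dots> \<le> norm (u - v) / 2"
        using f_bound[of ?m "u - v"] by (simp add: exp_minus field_simps)
      finally show "dist (apply_bcontfun (Bcontfun (T u)) t) (apply_bcontfun (Bcontfun (T v)) t)
          \<le> 1/2 * dist u v"
        by (simp add: Bcontfun_inverse[OF T_bcont] dist_norm)
    qed
  qed auto
  then obtain u where "Bcontfun (T u) = u" by blast
  then have fixpoint: "T u t = apply_bcontfun u t" for t
    using Bcontfun_inverse[OF T_bcont, of u] by simp
  define x where "x t = exp (K t) *\<^sub>R apply_bcontfun u t" for t
  have x_eq: "x t = x0 + integral {t0..t} (f u)" if "t \<ge> t0" for t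
    using that unfolding x_def fixpoint[symmetric] T_def by (simp add: exp_minus)
  have "(x has_vector_derivative A t (x t)) (at t within {t0..})" if "t \<ge> t0" for t
  proof -
    have "((\<lambda>t. x0 + integral {t0..t} (f u)) has_vector_derivative 0 + f u t) (at t within {t0..})"
      by (intro derivative_intros integral_halfline_has_vector_derivative f_cont that)
    then have "(x has_vector_derivative f u t) (at t within {t0..})"
      by (subst has_vector_derivative_cong_ev[where g = "\<lambda>t. x0 + integral {t0..t} (f u)"])
         (auto simp: x_eq that)
    then show ?thesis by (simp add: f_def x_def blinfun.scaleR_right)
  qed
  moreover have "x t0 = x0" by (simp add: x_eq)
  ultimately show ?thesis unfolding ode_solution_def by blast
qed

corollary second_order_real_solution_exists:
  fixes g :: "real \<Rightarrow> real"
  assumes g: "continuous_on {t0..} g"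
  obtains w z where "w t0 = a" "z t0 = b"
    "\<And>t. t \<ge> t0 \<Longrightarrow> (w has_real_derivative z t) (at t within {t0..})"
    "\<And>t. t \<ge> t0 \<Longrightarrow> (z has_real_derivative g t * w t) (at t within {t0..})"
proof -
  define B1 where "B1 = Blinfun (\<lambda>x::real \<times> real. (snd x, 0::real))"
  define B2 where "B2 = Blinfun (\<lambda>x::real \<times> real. (0::real, fst x))"
  have B1: "blinfun_apply B1 x = (snd x, 0)" for x
    unfolding B1_def by (subst bounded_linear_Blinfun_apply) (auto intro!: bounded_linear_intros)
  have B2: "blinfun_apply B2 x = (0, fst x)" for x
    unfolding B2_def by (subst bounded_linear_Blinfun_apply) (auto intro!: bounded_linear_intros)
  have "continuous_on {t0..} (\<lambda>t. B1 + g t *\<^sub>R B2)" by (intro continuous_intros g)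
  from linear_ode_solution_exists[OF this, of "(a, b)"] obtain x where
    x: "x t0 = (a, b)" "ode_solution (\<lambda>t. blinfun_apply (B1 + g t *\<^sub>R B2)) t0 x" by blast
  have der: "(x has_vector_derivative (snd (x t), g t * fst (x t))) (at t within {t0..})"
    if "t \<ge> t0" for t
    using x(2) that unfolding ode_solution_def
    by (auto simp: B1 B2 blinfun.add_left blinfun.scaleR_left)
  show thesis
  proof
    show "(fst \<circ> x) t0 = a" "(snd \<circ> x) t0 = b" by (auto simp: x)
    fix t assume t: "t \<ge> t0"
    show "((fst \<circ> x) has_real_derivative (snd \<circ> x) t) (at t within {t0..})"
      using bounded_linear.has_vector_derivative[OF bounded_linear_fst der[OF t]]
      by (simp add: has_real_derivative_iff_has_vector_derivative o_def)
    show "((snd \<circ> x) has_real_derivative g t * (fst \<circ> x) t) (at t within {t0..})"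
      using bounded_linear.has_vector_derivative[OF bounded_linear_snd der[OF t]]
      by (simp add: has_real_derivative_iff_has_vector_derivative o_def)
  qed
qed

section \<open>The growing solution of the normal form\<close>

text \<open>
  The choice \<open>w' = s\<close> at \<open>t0\<close> makes \<open>u - s\<close> and the reflection coefficient \<open>\<theta>\<close> vanish initially, so that
  the estimates below contain no initial terms.
\<close>
locale growing_solution =
  fixes t0 :: real and s s' w z :: "real \<Rightarrow> real"
  assumes s_pos: "t \<ge> t0 \<Longrightarrow> s t > 0"
    and s_deriv: "t \<ge> t0 \<Longrightarrow> (s has_real_derivative s' t) (at t within {t0..})"
    and w_deriv: "t \<ge> t0 \<Longrightarrow> (w has_real_derivative z t) (at t within {t0..})"
    and z_deriv: "t \<ge> t0 \<Longrightarrow> (z has_real_derivative (s t)\<^sup>2 * w t) (at t within {t0..})"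
    and w_init: "w t0 = 1" and z_init: "z t0 = s t0"
begin

text \<open>
  The product \<open>w z\<close> has derivative \<open>z\<^sup>2 + (s w)\<^sup>2 \<ge> 0\<close>, so it stays above its positive initial value. Hence
  \<open>w\<close> has no zero, \<open>w\<close> and \<open>z\<close> are both positive, and then both are nondecreasing.
\<close>
lemma w_z_lower:
  assumes t: "t \<ge> t0"
  shows "w t \<ge> 1" "z t \<ge> s t0"
proof -
  have s0: "s t0 > 0" by (simp add: s_pos)
  have wz: "w t * z t \<ge> s t0" if "t \<ge> t0" for t
  proof -
    have "w t0 * z t0 \<le> w t * z t"
      by (rule nondecreasing_halfline[where f = "\<lambda>t. w t * z t" and
          f' = "\<lambda>t. (z t)\<^sup>2 + (s t * w t)\<^sup>2" and ?t0.0 = t0])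
         (use that in \<open>auto intro!: derivative_eq_intros w_deriv z_deriv
            simp: power_mult_distrib power2_eq_square\<close>)
    then show ?thesis by (simp add: w_init z_init)
  qed
  have w_pos: "w t > 0" if "t \<ge> t0" for t
  proof (rule ccontr)
    assume "\<not> w t > 0"
    have "continuous_on {t0..t} w"
      by (rule continuous_on_subset[of "{t0..}"])
         (auto intro!: DERIV_continuous_on[where D = z] w_deriv)
    with \<open>\<not> w t > 0\<close> that obtain x where "t0 \<le> x" "w x = 0"
      using IVT2'[of w t 0 t0] by (auto simp: w_init)
    with wz[of x] s0 show False by simp
  qed
  have z_pos: "z t > 0" if "t \<ge> t0" for t
    using wz[OF that] w_pos[OF that] s0 by (meson less_le_trans zero_less_mult_pos)
  have "w t0 \<le> w t"
    by (rule nondecreasing_halfline[OF w_deriv]) (use t z_pos in \<open>auto intro: less_imp_le\<close>)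
  then show "w t \<ge> 1" by (simp add: w_init)
  have "z t0 \<le> z t"
    by (rule nondecreasing_halfline[OF z_deriv]) (use t in \<open>simp_all add: less_imp_le[OF w_pos]\<close>)
  then show "z t \<ge> s t0" by (simp add: z_init)
qed

lemma w_pos: "t \<ge> t0 \<Longrightarrow> w t > 0"
  using w_z_lower(1)[of t] by linarith

lemma z_pos: "t \<ge> t0 \<Longrightarrow> z t > 0"
  using w_z_lower(2)[of t] s_pos[of t0] by linarith

definition "u t = z t / w t"

lemma u_pos: "t \<ge> t0 \<Longrightarrow> u t > 0"
  by (simp add: u_def w_pos z_pos)

lemma u_init: "u t0 = s t0"
  by (simp add: u_def w_init z_init)

lemma u_deriv: "(u has_real_derivative (s t)\<^sup>2 - (u t)\<^sup>2) (at t within {t0..})" if t: "t \<ge> t0"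
proof -
  have "((\<lambda>t. z t / w t) has_real_derivative
      ((s t)\<^sup>2 * w t * w t - z t * z t) / (w t * w t)) (at t within {t0..})"
    using w_pos[OF t] by (intro DERIV_divide z_deriv w_deriv t) auto
  then show ?thesis
    unfolding u_def using w_pos[OF t] by (simp add: diff_divide_distrib power2_eq_square)
qed

text \<open>
  The difference \<open>v = u - s\<close> satisfies \<open>v' = - s' - v (s + u)\<close>. Because \<open>u > 0\<close>, the damping has rate at least \<open>s\<close>,
  while the forcing is at most \<open>k s\<close>; so \<open>(v\<^sup>2)' \<le> s (k\<^sup>2 - v\<^sup>2)\<close>, and \<open>v\<close> cannot leave \<open>[-k, k]\<close>. The function \<open>S\<close>
  supplies the integrating factor \<open>exp S\<close>.
\<close>
lemma u_near_s:
  assumes S: "\<And>t. t \<ge> t0 \<Longrightarrow> (S has_real_derivative s t) (at t within {t0..})"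
    and k: "\<And>t. t \<ge> t0 \<Longrightarrow> \<bar>s' t\<bar> \<le> k * s t"
    and t: "t \<ge> t0"
  shows "\<bar>u t - s t\<bar> \<le> k"
proof -
  have "0 \<le> k * s t0" using k[of t0] by linarith
  then have k0: "k \<ge> 0" using s_pos[of t0] by (simp add: zero_le_mult_iff)
  define v where "v t = u t - s t" for t
  define v2' where "v2' t = 2 * v t * ((s t)\<^sup>2 - (u t)\<^sup>2 - s' t)" for t
  have "((v t)\<^sup>2 - k\<^sup>2) * exp (S t) \<le> ((v t0)\<^sup>2 - k\<^sup>2) * exp (S t0)"
  proof (rule nonincreasing_halfline[where f = "\<lambda>t. ((v t)\<^sup>2 - k\<^sup>2) * exp (S t)" and f' =
        "\<lambda>t. (v2' t + s t * ((v t)\<^sup>2 - k\<^sup>2)) * exp (S t)" and ?t0.0 = t0])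
    fix t assume t: "t \<ge> t0"
    show "((\<lambda>t. ((v t)\<^sup>2 - k\<^sup>2) * exp (S t)) has_real_derivative
        (v2' t + s t * ((v t)\<^sup>2 - k\<^sup>2)) * exp (S t)) (at t within {t0..})"
      unfolding v_def v2'_def
      by (rule derivative_eq_intros u_deriv s_deriv S t refl)+ (simp add: algebra_simps)
    have "- 2 * v t * s' t \<le> 2 * \<bar>v t\<bar> * (k * s t)"
    proof -
      have "- 2 * v t * s' t \<le> \<bar>- 2 * v t * s' t\<bar>" by (rule abs_ge_self)
      also have "\<dots> = 2 * \<bar>v t\<bar> * \<bar>s' t\<bar>" by (simp add: abs_mult)
      also have "\<dots> \<le> 2 * \<bar>v t\<bar> * (k * s t)" by (intro mult_left_mono k t) auto
      finally show ?thesis .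
    qed
    also have "\<dots> = s t * (2 * (k * \<bar>v t\<bar>))" by simp
    also have "\<dots> \<le> s t * (k\<^sup>2 + (v t)\<^sup>2)"
      using sum_squares_bound[of k "\<bar>v t\<bar>"] s_pos[OF t] by (intro mult_left_mono) auto
    finally have "- 2 * v t * s' t \<le> s t * (k\<^sup>2 + (v t)\<^sup>2)" .
    moreover have "v2' t = - 2 * v t * s' t - 2 * s t * (v t)\<^sup>2 - 2 * u t * (v t)\<^sup>2"
      by (simp add: v2'_def v_def power2_eq_square algebra_simps)
    moreover have "u t * (v t)\<^sup>2 \<ge> 0" using u_pos[OF t] by simp
    ultimately have "v2' t + s t * ((v t)\<^sup>2 - k\<^sup>2) \<le> 0" by (simp add: algebra_simps)
    then show "(v2' t + s t * ((v t)\<^sup>2 - k\<^sup>2)) * exp (S t) \<le> 0"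
      by (intro mult_nonpos_nonneg) auto
  qed (use t in auto)
  also have "\<dots> \<le> 0" by (simp add: v_def u_init)
  finally have "(v t)\<^sup>2 \<le> k\<^sup>2" by (simp add: mult_le_0_iff)
  then have "\<bar>v t\<bar> \<le> k" using k0 by (simp add: abs_le_square_iff[symmetric])
  then show ?thesis by (simp add: v_def)
qed

text \<open>
  The Liouville-Green amplitude for a merely differentiable \<open>s\<close>. Let \<open>G\<close> be the logarithmic expression on the left
  and \<open>b = s' / (2 s)\<close>. Then \<open>G' = - b \<theta>\<close> and \<open>(\<theta>\<^sup>2)' \<le> - 4 s \<theta>\<^sup>2 + 2 \<bar>b \<theta>\<bar>\<close>. By the inequality between the arithmetic
  and the geometric mean \<open>3 \<bar>b \<theta>\<bar> \<le> 4 s \<theta>\<^sup>2 + j\<close>, so both functions \<open>\<theta>\<^sup>2 \<plusminus> G - J\<close> are nonincreasing, and \<open>\<theta> = 0\<close> at \<open>t0\<close>.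
\<close>
lemma log_amplitude:
  assumes S: "\<And>t. t \<ge> t0 \<Longrightarrow> (S has_real_derivative s t) (at t within {t0..})"
    and S0: "S t0 = 0"
    and J: "\<And>t. t \<ge> t0 \<Longrightarrow> (J has_real_derivative j t) (at t within {t0..})"
    and j: "\<And>t. t \<ge> t0 \<Longrightarrow> (s' t / s t)\<^sup>2 / s t \<le> j t"
    and t: "t \<ge> t0"
  shows "\<bar>ln (w t) + ln (s t) / 2 - S t + ln ((u t + s t) / s t) - (ln (s t0) / 2 + ln 2)\<bar>
    \<le> J t - J t0"
proof -
  define G where "G t = ln (w t) - ln (s t) / 2 - S t + ln (u t + s t)" for t
  define \<theta> where "\<theta> t = (u t - s t) / (u t + s t)" for t
  define b where "b t = s' t / (2 * s t)" for t
  define \<theta>' where "\<theta>' t = - 2 * s t * \<theta> t - b t * (1 - (\<theta> t)\<^sup>2)" for t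
  have \<sigma>: "u t + s t > 0" if "t \<ge> t0" for t using u_pos[OF that] s_pos[OF that] by simp
  have ln_deriv: "((\<lambda>t. ln (f t)) has_real_derivative f' / f t) (at t within {t0..})"
    if "(f has_real_derivative f') (at t within {t0..})" "f t > 0" for f f' t
    using that by (auto intro!: derivative_eq_intros simp: field_simps)
  have G_deriv: "(G has_real_derivative - b t * \<theta> t) (at t within {t0..})" if t: "t \<ge> t0" for t
  proof -
    note pos = w_pos[OF t] s_pos[OF t] \<sigma>[OF t]
    have ln_w: "((\<lambda>t. ln (w t)) has_real_derivative u t) (at t within {t0..})"
      unfolding u_def by (intro ln_deriv w_deriv t pos)
    have "(G has_real_derivative u t - s' t / s t / 2 - s t +
        ((s t)\<^sup>2 - (u t)\<^sup>2 + s' t) / (u t + s t)) (at t within {t0..})"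
      unfolding G_def
      by (intro DERIV_add DERIV_diff DERIV_cdivide ln_w ln_deriv s_deriv S u_deriv t pos)
    moreover have "u t - s' t / s t / 2 - s t + ((s t)\<^sup>2 - (u t)\<^sup>2 + s' t) / (u t + s t)
        = - b t * \<theta> t"
      unfolding b_def \<theta>_def using pos
      by (simp add: divide_simps power2_eq_square) (simp add: algebra_simps)
    ultimately show ?thesis by simp
  qed
  have \<theta>_deriv: "(\<theta> has_real_derivative \<theta>' t) (at t within {t0..})" if t: "t \<ge> t0" for t
  proof -
    note pos = s_pos[OF t] \<sigma>[OF t]
    have "(\<theta> has_real_derivative (((s t)\<^sup>2 - (u t)\<^sup>2 - s' t) * (u t + s t)
        - (u t - s t) * ((s t)\<^sup>2 - (u t)\<^sup>2 + s' t)) / ((u t + s t) * (u t + s t))) (at t within {t0..})"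
      unfolding \<theta>_def using pos
      by (intro DERIV_divide derivative_intros u_deriv s_deriv t) auto
    moreover have "(((s t)\<^sup>2 - (u t)\<^sup>2 - s' t) * (u t + s t)
        - (u t - s t) * ((s t)\<^sup>2 - (u t)\<^sup>2 + s' t)) / ((u t + s t) * (u t + s t)) = \<theta>' t"
      unfolding \<theta>'_def \<theta>_def b_def using pos
      by (simp add: divide_simps power2_eq_square) (simp add: algebra_simps)
    ultimately show ?thesis by simp
  qed
  have \<theta>_less: "(\<theta> t)\<^sup>2 \<le> 1" if "t \<ge> t0" for t
    using u_pos[OF that] s_pos[OF that]
    by (simp add: \<theta>_def abs_square_le_1 abs_le_iff divide_le_eq_1 minus_le_iff le_divide_eq)
  have slope: "2 * \<theta> t * \<theta>' t + \<bar>b t * \<theta> t\<bar> \<le> j t" if t: "t \<ge> t0" for t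
  proof -
    have s: "s t > 0" by (rule s_pos[OF t])
    have "- (2 * \<theta> t * b t * (1 - (\<theta> t)\<^sup>2)) \<le> \<bar>2 * \<theta> t * b t * (1 - (\<theta> t)\<^sup>2)\<bar>"
      by (rule abs_ge_minus_self)
    also have "\<dots> = 2 * \<bar>b t * \<theta> t\<bar> * (1 - (\<theta> t)\<^sup>2)"
      using \<theta>_less[OF t] by (simp add: abs_mult)
    also have "\<dots> \<le> 2 * \<bar>b t * \<theta> t\<bar> * 1"
      by (intro mult_left_mono) auto
    finally have "2 * \<theta> t * \<theta>' t + \<bar>b t * \<theta> t\<bar> \<le> 3 * \<bar>b t * \<theta> t\<bar> - 4 * s t * (\<theta> t)\<^sup>2"
      by (simp add: \<theta>'_def power2_eq_square algebra_simps)
    also have "\<dots> \<le> 4 * (b t)\<^sup>2 / s t"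
    proof -
      have "0 \<le> (2 * s t * \<bar>\<theta> t\<bar> - 2 * \<bar>b t\<bar>)\<^sup>2 + 5 * (s t * (\<bar>b t\<bar> * \<bar>\<theta> t\<bar>))"
        using s by simp
      also have "\<dots> = s t * (4 * (b t)\<^sup>2 / s t - (3 * \<bar>b t * \<theta> t\<bar> - 4 * s t * (\<theta> t)\<^sup>2))"
        using s by (simp add: power2_diff abs_mult power_mult_distrib)
          (simp add: power2_eq_square algebra_simps)
      finally show ?thesis using s by (simp add: zero_le_mult_iff)
    qed
    also have "\<dots> = (s' t / s t)\<^sup>2 / s t" by (simp add: b_def power_divide)
    also have "\<dots> \<le> j t" by (rule j[OF t])
    finally show ?thesis .
  qed
  have bound: "\<gamma> * (G t - G t0) \<le> J t - J t0" if \<gamma>: "\<bar>\<gamma>\<bar> = 1" for \<gamma>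
  proof -
    have "(\<theta> t)\<^sup>2 + \<gamma> * G t - J t \<le> (\<theta> t0)\<^sup>2 + \<gamma> * G t0 - J t0"
    proof (rule nonincreasing_halfline[where f = "\<lambda>t. (\<theta> t)\<^sup>2 + \<gamma> * G t - J t" and f' =
          "\<lambda>t. 2 * \<theta> t * \<theta>' t + \<gamma> * (- b t * \<theta> t) - j t" and ?t0.0 = t0])
      fix t assume t: "t \<ge> t0"
      show "((\<lambda>t. (\<theta> t)\<^sup>2 + \<gamma> * G t - J t) has_real_derivative
          2 * \<theta> t * \<theta>' t + \<gamma> * (- b t * \<theta> t) - j t) (at t within {t0..})"
        by (rule derivative_eq_intros \<theta>_deriv G_deriv J t refl)+ simp
      have "\<gamma> * (- b t * \<theta> t) \<le> \<bar>b t * \<theta> t\<bar>"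
        using abs_ge_self[of "\<gamma> * (- b t * \<theta> t)"] \<gamma> by (simp add: abs_mult)
      with slope[OF t] show "2 * \<theta> t * \<theta>' t + \<gamma> * (- b t * \<theta> t) - j t \<le> 0" by linarith
    qed (use t in auto)
    moreover have "\<theta> t0 = 0" by (simp add: \<theta>_def u_init)
    ultimately show ?thesis by (simp add: algebra_simps) (smt (verit) zero_le_power2)
  qed
  have "\<bar>G t - G t0\<bar> \<le> J t - J t0" using bound[of 1] bound[of "- 1"] by auto
  moreover have "G t0 = ln (s t0) / 2 + ln 2"
  proof -
    have "ln (s t0 + s t0) = ln 2 + ln (s t0)"
      using s_pos[of t0] by (simp flip: ln_mult_pos mult_2)
    then show ?thesis by (simp add: G_def u_init w_init S0)
  qed
  moreover have "G t = ln (w t) + ln (s t) / 2 - S t + ln ((u t + s t) / s t)"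
    using \<sigma>[OF t] s_pos[OF t] by (simp add: G_def ln_div)
  ultimately show ?thesis by simp
qed

end

section \<open>All solutions of the equation in terms of a growing one\<close>

lemma ode_solution_first_order_system_iff:
  "ode_solution (first_order_system p q) t0 y \<longleftrightarrow>
    (\<forall>t\<ge>t0. ((\<lambda>t. fst (y t)) has_vector_derivative snd (y t)) (at t within {t0..}) \<and>
      ((\<lambda>t. snd (y t)) has_vector_derivative - q t * fst (y t) - p t * snd (y t))
        (at t within {t0..}))"
  (is "_ \<longleftrightarrow> ?R")
proof
  assume y: "ode_solution (first_order_system p q) t0 y"
  show ?R
  proof (intro allI impI)
    fix t assume "t \<ge> t0"
    then have "(y has_vector_derivative (snd (y t), - q t * fst (y t) - p t * snd (y t)))
        (at t within {t0..})"
      using y by (simp add: ode_solution_def first_order_system_def case_prod_beta)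
    from bounded_linear.has_vector_derivative[OF bounded_linear_fst this]
      bounded_linear.has_vector_derivative[OF bounded_linear_snd this]
    show "((\<lambda>t. fst (y t)) has_vector_derivative snd (y t)) (at t within {t0..}) \<and>
      ((\<lambda>t. snd (y t)) has_vector_derivative - q t * fst (y t) - p t * snd (y t))
        (at t within {t0..})" by simp
  qed
next
  assume R: ?R
  show "ode_solution (first_order_system p q) t0 y"
    unfolding ode_solution_def
  proof (intro allI impI)
    fix t assume "t \<ge> t0"
    with R have "((\<lambda>t. (fst (y t), snd (y t))) has_vector_derivative
        (snd (y t), - q t * fst (y t) - p t * snd (y t))) (at t within {t0..})"
      by (intro has_vector_derivative_Pair) auto
    then show "(y has_vector_derivative first_order_system p q t (y t)) (at t within {t0..})"
      by (simp add: first_order_system_def case_prod_beta)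
  qed
qed

text \<open>
  The derivative witnessing a solution of the second order equation is the second component of a solution of
  the system, so that statements about either equation can be read off the other.
\<close>
lemma second_order_solution_iff:
  "second_order_solution p q t0 \<phi> \<longleftrightarrow>
    (\<exists>\<psi>. ode_solution (first_order_system p q) t0 (\<lambda>t. (\<phi> t, \<psi> t)))"
proof
  assume "second_order_solution p q t0 \<phi>"
  then obtain \<psi> \<psi>' where *: "\<And>t. t \<ge> t0 \<Longrightarrow> (\<phi> has_vector_derivative \<psi> t) (at t within {t0..})"
    "\<And>t. t \<ge> t0 \<Longrightarrow> (\<psi> has_vector_derivative \<psi>' t) (at t within {t0..})"
    "\<And>t. t \<ge> t0 \<Longrightarrow> \<psi>' t + p t * \<psi> t + q t * \<phi> t = 0"
    unfolding second_order_solution_def by blast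
  have "\<psi>' t = - q t * \<phi> t - p t * \<psi> t" if "t \<ge> t0" for t
    using *(3)[OF that] by (simp add: algebra_simps add_eq_0_iff2)
  with * show "\<exists>\<psi>. ode_solution (first_order_system p q) t0 (\<lambda>t. (\<phi> t, \<psi> t))"
    unfolding ode_solution_first_order_system_iff by (intro exI[of _ \<psi>]) auto
next
  assume "\<exists>\<psi>. ode_solution (first_order_system p q) t0 (\<lambda>t. (\<phi> t, \<psi> t))"
  then obtain \<psi> where "ode_solution (first_order_system p q) t0 (\<lambda>t. (\<phi> t, \<psi> t))" ..
  then show "second_order_solution p q t0 \<phi>"
    unfolding ode_solution_first_order_system_iff second_order_solution_def
    by (intro exI[of _ \<psi>] exI[of _ "\<lambda>t. - q t * \<phi> t - p t * \<psi> t"]) auto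
qed

text \<open>
  The substitution \<open>\<phi> = exp (- P / 2) * w\<close> removes the first order term: \<open>\<phi>'' + p \<phi>' + q \<phi> = 0\<close> holds exactly if
  \<open>w'' = (p' / 2 + p\<^sup>2 / 4 - q) w\<close>. The positive lower bound \<open>m\<close> on \<open>w' = z\<close> is what makes \<open>1 / w\<^sup>2\<close> integrable.
\<close>
locale liouville_transformation =
  fixes t0 :: real and p p' q P :: "real \<Rightarrow> complex" and g w z :: "real \<Rightarrow> real" and m :: real
  assumes P_deriv: "t \<ge> t0 \<Longrightarrow> (P has_vector_derivative p t) (at t within {t0..})"
    and p_deriv: "t \<ge> t0 \<Longrightarrow> (p has_vector_derivative p' t) (at t within {t0..})"
    and g_eq: "t \<ge> t0 \<Longrightarrow> complex_of_real (g t) = p' t / 2 + (p t)\<^sup>2 / 4 - q t"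
    and w_deriv: "t \<ge> t0 \<Longrightarrow> (w has_real_derivative z t) (at t within {t0..})"
    and z_deriv: "t \<ge> t0 \<Longrightarrow> (z has_real_derivative g t * w t) (at t within {t0..})"
    and w_ge: "t \<ge> t0 \<Longrightarrow> w t \<ge> 1"
    and z_ge: "t \<ge> t0 \<Longrightarrow> z t \<ge> m" and m_pos: "m > 0"
begin

text \<open>
  \<open>(\<Phi>, \<Psi>)\<close> is the solution of the first order system belonging to \<open>w\<close>, and \<open>F\<close> is the
  reciprocal of \<open>E\<close>, written as an exponential so that only products have to be differentiated.
\<close>
definition "E t = exp (- P t / 2)"
definition "F t = exp (P t / 2)"
definition "\<Phi> t = E t * of_real (w t)"
definition "\<Psi> t = E t * (of_real (z t) - p t / 2 * of_real (w t))"
definition "I t = integral {t0..t} (\<lambda>\<tau>. 1 / (w \<tau>)\<^sup>2)"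

lemma E_F: "E t * F t = 1"
  unfolding E_def F_def by (simp flip: exp_add)

lemma E_deriv: "(E has_vector_derivative - p t / 2 * E t) (at t within {t0..})" if "t \<ge> t0"
proof -
  have "((exp \<circ> (\<lambda>t. - P t / 2)) has_vector_derivative (- p t / 2) * exp (- P t / 2)) (at t within {t0..})"
    by (intro field_vector_diff_chain_within derivative_intros P_deriv that DERIV_subset[OF DERIV_exp]) auto
  then show ?thesis by (simp add: E_def[abs_def] o_def)
qed

lemma F_deriv: "(F has_vector_derivative p t / 2 * F t) (at t within {t0..})" if "t \<ge> t0"
proof -
  have "((exp \<circ> (\<lambda>t. P t / 2)) has_vector_derivative (p t / 2) * exp (P t / 2)) (at t within {t0..})"
    by (intro field_vector_diff_chain_within derivative_intros P_deriv that DERIV_subset[OF DERIV_exp]) auto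
  then show ?thesis by (simp add: F_def[abs_def] o_def)
qed

lemma of_real_deriv:
  "(f has_real_derivative d) (at t within S) \<Longrightarrow>
    ((\<lambda>t. complex_of_real (f t)) has_vector_derivative of_real d) (at t within S)"
  by (auto intro: has_vector_derivative_of_real simp: has_real_derivative_iff_has_vector_derivative)

lemma \<Phi>_deriv: "(\<Phi> has_vector_derivative \<Psi> t) (at t within {t0..})" if "t \<ge> t0"
proof -
  have "(\<Phi> has_vector_derivative E t * of_real (z t) + - p t / 2 * E t * of_real (w t))
      (at t within {t0..})"
    unfolding \<Phi>_def by (intro derivative_intros E_deriv of_real_deriv w_deriv that)
  then show ?thesis by (simp add: \<Psi>_def algebra_simps)
qed

lemma \<Psi>_deriv: "(\<Psi> has_vector_derivative - q t * \<Phi> t - p t * \<Psi> t) (at t within {t0..})"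
  if "t \<ge> t0"
proof -
  have "(\<Psi> has_vector_derivative
      E t * (of_real (g t * w t) - (p t / 2 * of_real (z t) + p' t / 2 * of_real (w t))) +
      - p t / 2 * E t * (of_real (z t) - p t / 2 * of_real (w t))) (at t within {t0..})"
    unfolding \<Psi>_def
    by (intro derivative_intros E_deriv of_real_deriv w_deriv z_deriv p_deriv that)
  moreover have "E t * (of_real (g t * w t) - (p t / 2 * of_real (z t) + p' t / 2 * of_real (w t))) +
      - p t / 2 * E t * (of_real (z t) - p t / 2 * of_real (w t)) = - q t * \<Phi> t - p t * \<Psi> t"
    unfolding of_real_mult g_eq[OF that] \<Psi>_def \<Phi>_def
    by (simp add: field_simps power2_eq_square)
  ultimately show ?thesis by simp
qed

lemma growing_is_solution: "ode_solution (first_order_system p q) t0 (\<lambda>t. (\<Phi> t, \<Psi> t))"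
  unfolding ode_solution_first_order_system_iff using \<Phi>_deriv \<Psi>_deriv by simp

lemma I_deriv: "(I has_real_derivative 1 / (w t)\<^sup>2) (at t within {t0..})" if "t \<ge> t0"
  unfolding I_def has_real_derivative_iff_has_vector_derivative
proof (rule integral_halfline_has_vector_derivative[OF _ that])
  have "continuous_on {t0..} w" by (rule DERIV_continuous_on[where D = z]) (auto intro: w_deriv)
  moreover have "w t \<noteq> 0" if "t \<ge> t0" for t using w_ge[OF that] by simp
  ultimately show "continuous_on {t0..} (\<lambda>\<tau>. 1 / (w \<tau>)\<^sup>2)" by (auto intro!: continuous_intros)
qed

text \<open>
  Since \<open>(1 / w)' = - z / w\<^sup>2 \<le> - m / w\<^sup>2\<close>, the function \<open>m I + 1 / w\<close> is nonincreasing.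
\<close>
lemma I_bound: "\<bar>I t\<bar> \<le> 1 / m" if "t \<ge> t0"
proof -
  have w0: "w t > 0" if "t \<ge> t0" for t using w_ge[OF that] by simp
  have "m * I t + 1 / w t \<le> m * I t0 + 1 / w t0"
  proof (rule nonincreasing_halfline[where f = "\<lambda>t. m * I t + 1 / w t" and
        f' = "\<lambda>t. (m - z t) / (w t)\<^sup>2" and ?t0.0 = t0])
    fix t assume t: "t \<ge> t0"
    show "((\<lambda>t. m * I t + 1 / w t) has_real_derivative (m - z t) / (w t)\<^sup>2) (at t within {t0..})"
      using w0[OF t]
      by (auto intro!: derivative_eq_intros I_deriv w_deriv t simp: field_simps power2_eq_square)
    show "(m - z t) / (w t)\<^sup>2 \<le> 0" using z_ge[OF t] by (simp add: divide_le_0_iff)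
  qed (use that in auto)
  moreover have "1 / w t > 0" "1 / w t0 \<le> 1" using w0[OF that] w_ge[of t0] by auto
  moreover have "m * I t0 = 0" by (simp add: I_def)
  ultimately have "m * I t \<le> 1" by linarith
  moreover have "I t0 \<le> I t"
    by (rule nondecreasing_halfline[OF I_deriv]) (use that in auto)
  then have "0 \<le> I t" by (simp add: I_def)
  ultimately show ?thesis using m_pos by (simp add: field_simps)
qed

text \<open>
  Reduction of order. By Liouville's formula the Wronskian of \<open>\<Phi>\<close> and \<open>\<phi>\<close> is a constant \<open>c\<close> times \<open>E\<^sup>2\<close>, and
  \<open>(\<phi> / \<Phi>)'\<close> is the Wronskian divided by \<open>\<Phi>\<^sup>2 = E\<^sup>2 w\<^sup>2\<close>, that is \<open>c / w\<^sup>2\<close>. So \<open>\<phi> / \<Phi> - c I\<close> is constant. The constants are expressed by the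
  values at an arbitrary time \<open>t1\<close>, because stability quantifies over all initial times.
\<close>
lemma general_solution:
  assumes y: "ode_solution (first_order_system p q) t0 (\<lambda>t. (\<phi> t, \<psi> t))"
    and t: "t1 \<ge> t0" "t \<ge> t0"
  defines "c \<equiv> (\<Phi> t1 * \<psi> t1 - \<Psi> t1 * \<phi> t1) * (F t1)\<^sup>2"
  defines "\<kappa> \<equiv> \<phi> t1 * F t1 * of_real (1 / w t1) + c * of_real (I t - I t1)"
  shows "\<phi> t = \<kappa> * \<Phi> t" "\<psi> t = \<kappa> * \<Psi> t + c * E t * of_real (1 / w t)"
proof -
  have d: "(\<phi> has_vector_derivative \<psi> t) (at t within {t0..})"
    "(\<psi> has_vector_derivative - q t * \<phi> t - p t * \<psi> t) (at t within {t0..})" if "t \<ge> t0" for t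
    using y that by (auto simp: ode_solution_first_order_system_iff)
  have w: "w t > 0" if "t \<ge> t0" for t using w_ge[OF that] by simp
  define \<omega> where "\<omega> t = \<Phi> t * \<psi> t - \<Psi> t * \<phi> t" for t
  have \<omega>: "\<omega> t * (F t)\<^sup>2 = c" if "t \<ge> t0" for t
    unfolding c_def \<omega>_def[symmetric] power2_eq_square
  proof (rule constant_halfline[where f = "\<lambda>t. \<omega> t * (F t * F t)", OF _ that t(1)])
    fix t assume t: "t \<ge> t0"
    have "((\<lambda>t. \<omega> t * (F t * F t)) has_vector_derivative
       \<omega> t * (F t * (p t / 2 * F t) + p t / 2 * F t * F t) +
       ((\<Phi> t * (- q t * \<phi> t - p t * \<psi> t) + \<Psi> t * \<psi> t) -
        (\<Psi> t * \<psi> t + (- q t * \<Phi> t - p t * \<Psi> t) * \<phi> t)) * (F t * F t)) (at t within {t0..})"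
      unfolding \<omega>_def by (intro derivative_intros d F_deriv \<Phi>_deriv \<Psi>_deriv t)
    moreover have "\<omega> t * (F t * (p t / 2 * F t) + p t / 2 * F t * F t) +
       ((\<Phi> t * (- q t * \<phi> t - p t * \<psi> t) + \<Psi> t * \<psi> t) -
        (\<Psi> t * \<psi> t + (- q t * \<Phi> t - p t * \<Psi> t) * \<phi> t)) * (F t * F t) = 0"
      unfolding \<omega>_def by (simp add: field_simps)
    ultimately show "((\<lambda>t. \<omega> t * (F t * F t)) has_vector_derivative 0) (at t within {t0..})"
      by simp
  qed
  define R where "R t = \<phi> t * F t * of_real (1 / w t)" for t
  have E0: "E t \<noteq> 0" "F t \<noteq> 0" for t by (auto simp: E_def F_def)
  have E_inv: "E t = 1 / F t" for t using E_F[of t] E0[of t] by (simp add: field_simps)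
  have "R t - c * of_real (I t) = R t1 - c * of_real (I t1)"
  proof (rule constant_halfline[where f = "\<lambda>t. R t - c * of_real (I t)", OF _ t(2,1)])
    fix t assume t: "t \<ge> t0"
    have wd: "((\<lambda>t. 1 / w t) has_real_derivative - z t / (w t)\<^sup>2) (at t within {t0..})"
      using w[OF t] by (auto intro!: derivative_eq_intros w_deriv t simp: field_simps power2_eq_square)
    have "((\<lambda>t. R t - c * of_real (I t)) has_vector_derivative
        \<phi> t * F t * of_real (- z t / (w t)\<^sup>2) +
        (\<phi> t * (p t / 2 * F t) + \<psi> t * F t) * of_real (1 / w t)
        - c * of_real (1 / (w t)\<^sup>2)) (at t within {t0..})"
      unfolding R_def
      by (intro derivative_intros d F_deriv of_real_deriv[OF wd] of_real_deriv[OF I_deriv]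
          has_vector_derivative_mult_right t)
    moreover have "\<phi> t * F t * of_real (- z t / (w t)\<^sup>2) +
        (\<phi> t * (p t / 2 * F t) + \<psi> t * F t) * of_real (1 / w t)
        - c * of_real (1 / (w t)\<^sup>2) = 0"
      unfolding \<omega>[OF t, symmetric] \<omega>_def \<Phi>_def \<Psi>_def E_inv using w[OF t] E0(2)[of t]
      by (simp add: field_simps power2_eq_square)
    ultimately show "((\<lambda>t. R t - c * of_real (I t)) has_vector_derivative 0) (at t within {t0..})"
      by simp
  qed
  then have "R t = \<kappa>" by (simp add: \<kappa>_def R_def algebra_simps)
  then show \<phi>: "\<phi> t = \<kappa> * \<Phi> t"
    unfolding R_def \<Phi>_def E_inv using w[OF t(2)] E0(2)[of t] by (auto simp: field_simps)
  have "\<Phi> t * \<psi> t - \<Psi> t * \<phi> t = c * (E t)\<^sup>2"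
    using \<omega>[OF t(2)] E0(2)[of t] unfolding \<omega>_def E_inv by (simp add: field_simps)
  then have "\<Phi> t * \<psi> t = \<Phi> t * (\<kappa> * \<Psi> t + c * E t * of_real (1 / w t))"
    unfolding \<phi> using w[OF t(2)] by (simp add: \<Phi>_def field_simps power2_eq_square)
  moreover have "\<Phi> t \<noteq> 0" using w[OF t(2)] E0(1)[of t] by (simp add: \<Phi>_def)
  ultimately show "\<psi> t = \<kappa> * \<Psi> t + c * E t * of_real (1 / w t)" by simp
qed

text \<open>
  In the general solution, \<open>\<kappa>\<close> and \<open>c\<close> are bounded by a multiple of the initial value, as \<open>I\<close> is bounded. The additional
  term \<open>c E / w\<close> of the derivative is harmless because \<open>w \<ge> 1\<close> gives \<open>\<bar>E / w\<bar> \<le> \<bar>E w\<bar> = \<bar>\<Phi>\<bar>\<close>.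
\<close>
lemma solutions_dominated:
  assumes t1: "t1 \<ge> t0"
  shows "\<exists>C>0. \<forall>y t. ode_solution (first_order_system p q) t0 y \<longrightarrow> t \<ge> t0 \<longrightarrow>
    norm (fst (y t)) \<le> C * norm (y t1) * norm (\<Phi> t) \<and>
    norm (y t) \<le> C * norm (y t1) * norm (\<Phi> t, \<Psi> t)"
proof -
  define C1 where "C1 = (norm (\<Phi> t1) + norm (\<Psi> t1)) * (norm (F t1))\<^sup>2"
  define C2 where "C2 = norm (F t1) + C1 * (2 / m)"
  have pos: "C1 \<ge> 0" "C2 > 0" using m_pos by (auto simp: C1_def C2_def F_def intro!: add_pos_nonneg)
  show ?thesis
  proof (intro exI[of _ "C2 + C1"] conjI allI impI)
    fix y t assume y: "ode_solution (first_order_system p q) t0 y" and t: "t \<ge> t0"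
    define n where "n = norm (y t1)"
    define c where "c = (\<Phi> t1 * snd (y t1) - \<Psi> t1 * fst (y t1)) * (F t1)\<^sup>2"
    define \<kappa> where "\<kappa> = fst (y t1) * F t1 * of_real (1 / w t1) + c * of_real (I t - I t1)"
    from y have "ode_solution (first_order_system p q) t0 (\<lambda>t. (fst (y t), snd (y t)))" by simp
    from general_solution[OF this t1 t, folded c_def, folded \<kappa>_def]
    have eq: "fst (y t) = \<kappa> * \<Phi> t" "snd (y t) = \<kappa> * \<Psi> t + c * E t * of_real (1 / w t)" .
    have n: "norm (fst (y t1)) \<le> n" "norm (snd (y t1)) \<le> n" "n \<ge> 0"
      by (metis n_def norm_fst_le norm_snd_le norm_ge_zero prod.collapse)+
    have c: "norm c \<le> C1 * n"
    proof -
      have "norm (\<Phi> t1 * snd (y t1) - \<Psi> t1 * fst (y t1)) \<le> norm (\<Phi> t1) * n + norm (\<Psi> t1) * n"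
        by (rule order_trans[OF norm_triangle_ineq4])
           (auto simp: norm_mult intro!: add_mono mult_left_mono n)
      then have "norm c \<le> (norm (\<Phi> t1) * n + norm (\<Psi> t1) * n) * (norm (F t1))\<^sup>2"
        unfolding c_def norm_mult norm_power by (intro mult_right_mono) auto
      then show ?thesis by (simp add: C1_def algebra_simps)
    qed
    have \<kappa>: "norm \<kappa> \<le> C2 * n"
    proof -
      have "norm (fst (y t1) * F t1 * of_real (1 / w t1)) \<le> n * norm (F t1) * 1"
        unfolding norm_mult using w_ge[OF t1] n(3)
        by (intro mult_mono n mult_nonneg_nonneg) (auto simp: norm_divide)
      moreover have "norm (c * of_real (I t - I t1)) \<le> C1 * n * (2 / m)"
        unfolding norm_mult norm_of_real using I_bound[OF t] I_bound[OF t1] pos n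
        by (intro mult_mono c) auto
      ultimately show ?thesis unfolding \<kappa>_def C2_def
        by (intro order_trans[OF norm_triangle_ineq]) (simp add: algebra_simps)
    qed
    have "norm (fst (y t)) \<le> C2 * n * norm (\<Phi> t)"
      unfolding eq norm_mult by (intro mult_right_mono \<kappa>) auto
    also have "\<dots> \<le> (C2 + C1) * n * norm (\<Phi> t)"
      using pos n by (intro mult_right_mono) auto
    finally show "norm (fst (y t)) \<le> (C2 + C1) * norm (y t1) * norm (\<Phi> t)" by (simp add: n_def)
    have "y t = (\<kappa> * \<Phi> t, \<kappa> * \<Psi> t) + (0, c * E t * of_real (1 / w t))"
      by (simp add: prod_eq_iff eq)
    then have "norm (y t) \<le> norm (\<kappa> * \<Phi> t, \<kappa> * \<Psi> t) + norm (0::complex, c * E t * of_real (1 / w t))"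
      by (metis norm_triangle_ineq)
    also have "norm (\<kappa> * \<Phi> t, \<kappa> * \<Psi> t) = norm \<kappa> * norm (\<Phi> t, \<Psi> t)"
      by (simp add: norm_Pair norm_mult power_mult_distrib real_sqrt_mult flip: distrib_left)
    also have "norm (0::complex, c * E t * of_real (1 / w t)) \<le> norm c * norm (\<Phi> t, \<Psi> t)"
    proof -
      have "\<bar>1 / w t\<bar> \<le> \<bar>w t\<bar>"
        using w_ge[OF t] mult_mono[of 1 "w t" 1 "w t"] by (simp add: field_simps)
      then have "norm (E t * of_real (1 / w t)) \<le> norm (\<Phi> t)"
        unfolding \<Phi>_def norm_mult norm_of_real by (intro mult_left_mono) auto
      also have "\<dots> \<le> norm (\<Phi> t, \<Psi> t)" by (rule norm_fst_le)
      finally have "norm c * norm (E t * of_real (1 / w t)) \<le> norm c * norm (\<Phi> t, \<Psi> t)"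
        by (intro mult_left_mono) auto
      then show ?thesis by (simp add: norm_Pair2 norm_mult norm_divide)
    qed
    also have "norm \<kappa> * norm (\<Phi> t, \<Psi> t) + norm c * norm (\<Phi> t, \<Psi> t)
        \<le> C2 * n * norm (\<Phi> t, \<Psi> t) + C1 * n * norm (\<Phi> t, \<Psi> t)"
      by (intro add_mono mult_right_mono \<kappa> c) auto
    finally show "norm (y t) \<le> (C2 + C1) * norm (y t1) * norm (\<Phi> t, \<Psi> t)"
      by (simp add: n_def algebra_simps)
  qed (use pos in auto)
qed

lemma second_order_dominated:
  assumes "second_order_solution p q t0 \<phi>"
  obtains K where "\<And>t. t \<ge> t0 \<Longrightarrow> norm (\<phi> t) \<le> K * norm (\<Phi> t)"
proof -
  from assms obtain \<psi> where y: "ode_solution (first_order_system p q) t0 (\<lambda>t. (\<phi> t, \<psi> t))"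
    unfolding second_order_solution_iff ..
  from solutions_dominated[of t0] obtain C where
    "\<And>y t. ode_solution (first_order_system p q) t0 y \<Longrightarrow> t \<ge> t0 \<Longrightarrow>
      norm (fst (y t)) \<le> C * norm (y t0) * norm (\<Phi> t)" by blast
  from this[OF y] show thesis by (intro that[of "C * norm (\<phi> t0, \<psi> t0)"]) simp
qed

lemma growing_is_second_order_solution: "second_order_solution p q t0 \<Phi>"
  using growing_is_solution by (auto simp: second_order_solution_iff)

theorem all_solutions_bounded_iff:
  "(\<forall>\<phi>. second_order_solution p q t0 \<phi> \<longrightarrow> bounded (\<phi> ` {t0..})) \<longleftrightarrow> bounded (\<Phi> ` {t0..})"
proof (intro iffI allI impI)
  fix \<phi> assume "bounded (\<Phi> ` {t0..})" and \<phi>: "second_order_solution p q t0 \<phi>"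
  then obtain B where B: "\<And>t. t \<ge> t0 \<Longrightarrow> norm (\<Phi> t) \<le> B" by (auto simp: bounded_iff)
  obtain K where K: "\<And>t. t \<ge> t0 \<Longrightarrow> norm (\<phi> t) \<le> K * norm (\<Phi> t)"
    using second_order_dominated[OF \<phi>] by blast
  have "norm (\<phi> t) \<le> \<bar>K\<bar> * B" if "t \<ge> t0" for t
  proof -
    have "norm (\<phi> t) \<le> K * norm (\<Phi> t)" by (rule K[OF that])
    also have "\<dots> \<le> \<bar>K\<bar> * B" using B[OF that] by (intro mult_mono) auto
    finally show ?thesis .
  qed
  then show "bounded (\<phi> ` {t0..})" by (auto simp: bounded_iff)
qed (use growing_is_second_order_solution in blast)

theorem all_solutions_vanish_iff:
  "(\<forall>\<phi>. second_order_solution p q t0 \<phi> \<longrightarrow> (\<phi> \<longlongrightarrow> 0) at_top) \<longleftrightarrow> (\<Phi> \<longlongrightarrow> 0) at_top"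
proof (intro iffI allI impI)
  fix \<phi> assume \<Phi>: "(\<Phi> \<longlongrightarrow> 0) at_top" and \<phi>: "second_order_solution p q t0 \<phi>"
  obtain K where K: "\<And>t. t \<ge> t0 \<Longrightarrow> norm (\<phi> t) \<le> K * norm (\<Phi> t)"
    using second_order_dominated[OF \<phi>] by blast
  have "((\<lambda>t. K * norm (\<Phi> t)) \<longlongrightarrow> 0) at_top"
    using tendsto_mult_right_zero[OF tendsto_norm_zero[OF \<Phi>]] .
  then show "(\<phi> \<longlongrightarrow> 0) at_top"
    by (rule Lim_null_comparison[rotated]) (use K in \<open>auto simp: eventually_at_top_linorder\<close>)
qed (use growing_is_second_order_solution in blast)


text \<open>
  Stability speaks about small initial values only; by linearity it still tests the growing solution, through a
  small multiple of it.
\<close>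
lemma small_growing_solution:
  assumes "d > 0"
  obtains r where "r > 0" "norm (r *\<^sub>R (\<Phi> t0, \<Psi> t0)) < d"
    "ode_solution (first_order_system p q) t0 (\<lambda>t. r *\<^sub>R (\<Phi> t, \<Psi> t))"
proof
  define n where "n = norm (\<Phi> t0, \<Psi> t0)"
  define r where "r = d / (1 + n)"
  have n: "n \<ge> 0" by (simp add: n_def)
  with assms show "r > 0" by (simp add: r_def)
  have "r * n < d" using n assms by (simp add: r_def field_simps)
  then show "norm (r *\<^sub>R (\<Phi> t0, \<Psi> t0)) < d"
    using \<open>r > 0\<close> unfolding norm_scaleR n_def by simp
  show "ode_solution (first_order_system p q) t0 (\<lambda>t. r *\<^sub>R (\<Phi> t, \<Psi> t))"
    unfolding ode_solution_first_order_system_iff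
    by (auto intro!: derivative_eq_intros \<Phi>_deriv \<Psi>_deriv simp: scaleR_diff_right)
qed

theorem liapunov_stable_iff:
  "liapunov_stable p q t0 \<longleftrightarrow> bounded ((\<lambda>t. (\<Phi> t, \<Psi> t)) ` {t0..})"
proof
  assume "liapunov_stable p q t0"
  then obtain d where d: "d > 0" and *: "\<And>y t. ode_solution (first_order_system p q) t0 y \<Longrightarrow>
      norm (y t0) < d \<Longrightarrow> t \<ge> t0 \<Longrightarrow> norm (y t) < 1"
    unfolding liapunov_stable_def liapunov_stable_solution_def
    by (metis diff_zero order_refl zero_less_one)
  obtain r where r: "r > 0" "norm (r *\<^sub>R (\<Phi> t0, \<Psi> t0)) < d"
    "ode_solution (first_order_system p q) t0 (\<lambda>t. r *\<^sub>R (\<Phi> t, \<Psi> t))"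
    using small_growing_solution[OF d] by blast
  have "norm (\<Phi> t, \<Psi> t) \<le> 1 / r" if "t \<ge> t0" for t
  proof -
    have "r * norm (\<Phi> t, \<Psi> t) < 1"
      using *[OF r(3) r(2) that] r(1) unfolding norm_scaleR by simp
    then show ?thesis using r(1) by (simp add: field_simps)
  qed
  then show "bounded ((\<lambda>t. (\<Phi> t, \<Psi> t)) ` {t0..})" by (auto simp: bounded_iff)
next
  assume "bounded ((\<lambda>t. (\<Phi> t, \<Psi> t)) ` {t0..})"
  then obtain B where B: "B > 0" "\<And>t. t \<ge> t0 \<Longrightarrow> norm (\<Phi> t, \<Psi> t) \<le> B"
    by (auto simp: bounded_pos)
  show "liapunov_stable p q t0"
    unfolding liapunov_stable_def liapunov_stable_solution_def
  proof (intro conjI allI impI)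
    show "ode_solution (first_order_system p q) t0 (\<lambda>t. 0)"
      by (simp add: ode_solution_first_order_system_iff)
    fix t1 e :: real assume t1: "t1 \<ge> t0" and e: "e > 0"
    obtain C where C: "C > 0" "\<And>y t. ode_solution (first_order_system p q) t0 y \<Longrightarrow> t \<ge> t0 \<Longrightarrow>
        norm (y t) \<le> C * norm (y t1) * norm (\<Phi> t, \<Psi> t)"
      using solutions_dominated[OF t1] by blast
    show "\<exists>d>0. \<forall>y. ode_solution (first_order_system p q) t0 y \<longrightarrow>
        norm (y t1 - 0) < d \<longrightarrow> (\<forall>t\<ge>t1. norm (y t - 0) < e)"
    proof (intro exI[of _ "e / (C * B)"] conjI allI impI)
      fix y t assume y: "ode_solution (first_order_system p q) t0 y"
        and small: "norm (y t1 - 0) < e / (C * B)" and t: "t1 \<le> t"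
      have "norm (y t) \<le> C * norm (y t1) * norm (\<Phi> t, \<Psi> t)" using C(2)[OF y] t t1 by simp
      also have "\<dots> \<le> C * norm (y t1) * B" using B(2) C(1) t t1 by (intro mult_left_mono) auto
      also have "\<dots> < e" using small B(1) C(1) by (simp add: field_simps)
      finally show "norm (y t - 0) < e" by simp
    qed (use e B(1) C(1) in auto)
  qed
qed

text \<open>
  Convergence of \<open>(\<Phi>, \<Psi>)\<close> to zero also yields Liapunov stability: the pair is then bounded near infinity, and on
  the remaining compact interval it is bounded by continuity.
\<close>
theorem asymptotically_stable_iff:
  "asymptotically_stable p q t0 \<longleftrightarrow> ((\<lambda>t. (\<Phi> t, \<Psi> t)) \<longlongrightarrow> 0) at_top"
proof
  assume "asymptotically_stable p q t0"
  then obtain d where d: "d > 0" and *: "\<And>y. ode_solution (first_order_system p q) t0 y \<Longrightarrow>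
      norm (y t0) < d \<Longrightarrow> (y \<longlongrightarrow> 0) at_top"
    unfolding asymptotically_stable_def asymptotically_stable_solution_def
    by (auto dest: spec[of _ t0])
  obtain r where r: "r > 0" "norm (r *\<^sub>R (\<Phi> t0, \<Psi> t0)) < d"
    "ode_solution (first_order_system p q) t0 (\<lambda>t. r *\<^sub>R (\<Phi> t, \<Psi> t))"
    using small_growing_solution[OF d] by blast
  from tendsto_scaleR[OF tendsto_const[of "1 / r"] *[OF r(3) r(2)]] r(1)
  show "((\<lambda>t. (\<Phi> t, \<Psi> t)) \<longlongrightarrow> 0) at_top" by simp
next
  assume lim: "((\<lambda>t. (\<Phi> t, \<Psi> t)) \<longlongrightarrow> 0) at_top"
  then have "\<forall>\<^sub>F t in at_top. norm (\<Phi> t, \<Psi> t) < 1"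
    using tendstoD[OF lim, of 1] by (simp add: dist_norm)
  then obtain T where T: "\<And>t. t \<ge> T \<Longrightarrow> norm (\<Phi> t, \<Psi> t) < 1"
    by (auto simp: eventually_at_top_linorder)
  have "continuous_on {t0..} (\<lambda>t. (\<Phi> t, \<Psi> t))"
    using \<Phi>_deriv \<Psi>_deriv
    by (auto simp: continuous_on_eq_continuous_within
        intro!: continuous_Pair intro: has_vector_derivative_continuous)
  then have "compact ((\<lambda>t. (\<Phi> t, \<Psi> t)) ` {t0..T})"
    by (intro compact_continuous_image) (auto intro: continuous_on_subset)
  then have "bounded ((\<lambda>t. (\<Phi> t, \<Psi> t)) ` {t0..T})" by (rule compact_imp_bounded)
  moreover have "bounded ((\<lambda>t. (\<Phi> t, \<Psi> t)) ` {T..})"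
    using T by (auto simp: bounded_iff intro!: exI[of _ 1] less_imp_le)
  ultimately have "bounded ((\<lambda>t. (\<Phi> t, \<Psi> t)) ` ({t0..T} \<union> {T..}))"
    by (simp add: image_Un)
  then have "bounded ((\<lambda>t. (\<Phi> t, \<Psi> t)) ` {t0..})"
    by (rule bounded_subset) auto
  then have "liapunov_stable p q t0" by (simp add: liapunov_stable_iff)
  moreover have "(y \<longlongrightarrow> 0) at_top"
    if t1: "t1 \<ge> t0" and y: "ode_solution (first_order_system p q) t0 y" for t1 y
  proof -
    obtain C where C: "\<And>t. t \<ge> t0 \<Longrightarrow> norm (y t) \<le> C * norm (y t1) * norm (\<Phi> t, \<Psi> t)"
      using solutions_dominated[OF t1] y by blast
    have "((\<lambda>t. C * norm (y t1) * norm (\<Phi> t, \<Psi> t)) \<longlongrightarrow> 0) at_top"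
      using tendsto_mult_right_zero[OF tendsto_norm_zero[OF lim]] .
    then show ?thesis
      by (rule Lim_null_comparison[rotated]) (use C in \<open>auto simp: eventually_at_top_linorder\<close>)
  qed
  ultimately show "asymptotically_stable p q t0"
    unfolding asymptotically_stable_def asymptotically_stable_solution_def liapunov_stable_def
    by (auto intro!: exI[of _ "1::real"])
qed

end

section \<open>Logarithmic comparison\<close>

text \<open>
  Only the size of a function up to a constant factor matters for its boundedness and its decay, and a bounded
  error in the logarithm is such a factor.
\<close>
lemma
  fixes f :: "real \<Rightarrow> 'a::real_normed_vector"
  assumes nz: "\<And>t. t \<ge> t0 \<Longrightarrow> f t \<noteq> 0"
    and log: "\<And>t. t \<ge> t0 \<Longrightarrow> \<bar>ln (norm (f t)) - r t / 2\<bar> \<le> M"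
  shows bounded_iff_log_bdd_above: "bounded (f ` {t0..}) \<longleftrightarrow> bdd_above (r ` {t0..})"
    and tendsto_0_iff_log_at_bot: "(f \<longlongrightarrow> 0) at_top \<longleftrightarrow> filterlim r at_bot at_top"
proof -
  have le_iff: "norm (f t) \<le> exp x \<longleftrightarrow> ln (norm (f t)) \<le> x" if "t \<ge> t0" for t x
    using nz[OF that] ln_le_cancel_iff[of "norm (f t)" "exp x"] by simp
  show "bounded (f ` {t0..}) \<longleftrightarrow> bdd_above (r ` {t0..})"
  proof
    assume "bounded (f ` {t0..})"
    then obtain B where B: "B > 0" "\<And>t. t \<ge> t0 \<Longrightarrow> norm (f t) \<le> B" by (auto simp: bounded_pos)
    have "r t \<le> 2 * (ln B + M)" if "t \<ge> t0" for t
      using le_iff[OF that, of "ln B"] B(1) B(2)[OF that] log[OF that] by (simp add: abs_le_iff)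
    then show "bdd_above (r ` {t0..})" by (auto simp: bdd_above_def)
  next
    assume "bdd_above (r ` {t0..})"
    then obtain B where "\<And>t. t \<ge> t0 \<Longrightarrow> r t \<le> B" by (auto simp: bdd_above_def)
    then have "norm (f t) \<le> exp (B / 2 + M)" if "t \<ge> t0" for t
      using le_iff[OF that] log[OF that] that by (smt (verit) divide_right_mono)
    then show "bounded (f ` {t0..})" by (auto simp: bounded_iff)
  qed
  show "(f \<longlongrightarrow> 0) at_top \<longleftrightarrow> filterlim r at_bot at_top"
  proof
    assume f: "(f \<longlongrightarrow> 0) at_top"
    show "filterlim r at_bot at_top"
      unfolding filterlim_at_bot
    proof
      fix Z
      have "\<forall>\<^sub>F t in at_top. norm (f t) < exp (Z / 2 - M)"
        using tendstoD[OF f, of "exp (Z / 2 - M)"] by simp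
      then show "\<forall>\<^sub>F t in at_top. r t \<le> Z"
        using eventually_ge_at_top[of t0]
      proof eventually_elim
        case (elim t)
        then show ?case using le_iff[of t "Z / 2 - M"] log[of t] by (simp add: abs_le_iff)
      qed
    qed
  next
    assume r: "filterlim r at_bot at_top"
    show "(f \<longlongrightarrow> 0) at_top"
    proof (rule tendstoI)
      fix e :: real assume e: "e > 0"
      have "\<forall>\<^sub>F t in at_top. r t \<le> 2 * (ln (e / 2) - M)"
        using r unfolding filterlim_at_bot by blast
      then show "\<forall>\<^sub>F t in at_top. dist (f t) 0 < e"
        using eventually_ge_at_top[of t0]
      proof eventually_elim
        case (elim t)
        then have "norm (f t) \<le> e / 2"
          using le_iff[of t "ln (e / 2)"] log[of t] e by (simp add: abs_le_iff)
        then show ?case using e by simp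
      qed
    qed
  qed
qed

text \<open>
  The norm of \<open>(\<Phi>, \<Phi>')\<close> is comparable to \<open>\<bar>\<Phi>\<bar> (1 + \<bar>\<Phi>' / \<Phi>\<bar>)\<close>. Here \<open>\<Phi>' / \<Phi> = u - p / 2\<close>, and replacing \<open>u\<close> by \<open>s\<close>
  costs at most \<open>k\<close>, which the summand \<open>1\<close> absorbs into a constant factor.
\<close>
lemma log_norm_solution_pair:
  fixes \<Phi> p :: complex and u s k :: real
  assumes \<Phi>: "\<Phi> \<noteq> 0" and us: "\<bar>u - s\<bar> \<le> k"
  shows "\<bar>ln (norm (\<Phi>, \<Phi> * (of_real u - p / 2))) - ln (norm \<Phi>)
    - ln (1 + norm (p - of_real (2 * s)))\<bar> \<le> ln (4 + 4 * k)"
proof -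
  define v b where "v = complex_of_real (u - s)" and "b = p - of_real (2 * s)"
  define A B where "A = 1 + norm (of_real u - p / 2)" and "B = 1 + norm b"
  define N where "N = norm (\<Phi>, \<Phi> * (of_real u - p / 2))"
  have k: "k \<ge> 0" using us by linarith
  have pos: "A \<ge> 1" "B \<ge> 1" "norm \<Phi> > 0" using \<Phi> by (auto simp: A_def B_def)
  have v: "norm v \<le> k" using us unfolding v_def by (simp only: norm_of_real)
  have vb: "of_real u - p / 2 = v - b / 2" by (simp add: v_def b_def field_simps)
  have "A - 1 \<le> k + (B - 1) / 2"
    using norm_triangle_ineq4[of v "b / 2"] v by (simp add: A_def B_def vb norm_divide)
  moreover have "k * 1 \<le> k * B" using k pos by (intro mult_left_mono) auto
  ultimately have AB: "A \<le> (1 + k) * B" using pos by (simp add: field_simps)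
  have "norm b \<le> norm (2 * v) + norm (2 * (v - b / 2))"
    using norm_triangle_ineq4[of "2 * v" "2 * (v - b / 2)"] by (simp add: algebra_simps)
  then have "B - 1 \<le> 2 * k + 2 * (A - 1)"
    unfolding norm_mult A_def B_def vb using v by simp
  moreover have "k * 1 \<le> k * A" using k pos by (intro mult_left_mono) auto
  ultimately have BA: "B \<le> (2 + 2 * k) * A" using pos by (simp add: algebra_simps)
  have N_le: "N \<le> norm \<Phi> * A"
    unfolding N_def A_def using norm_Pair_le[of \<Phi> "\<Phi> * (of_real u - p / 2)"]
    by (simp add: norm_mult distrib_left)
  have "norm \<Phi> \<le> N" "norm (\<Phi> * (of_real u - p / 2)) \<le> N"
    unfolding N_def by (rule norm_fst_le, rule norm_snd_le)
  then have N_ge: "norm \<Phi> * A \<le> 2 * N" by (simp add: A_def norm_mult distrib_left)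
  have N0: "N > 0" using N_ge pos by (smt (verit) mult_pos_pos)
  have "N \<le> norm \<Phi> * ((1 + k) * B)"
    using N_le mult_left_mono[OF AB, of "norm \<Phi>"] by simp
  also have "\<dots> \<le> norm \<Phi> * ((4 + 4 * k) * B)"
    using k pos by (intro mult_left_mono mult_right_mono) auto
  finally have "ln N \<le> ln (norm \<Phi> * ((4 + 4 * k) * B))"
    using N0 by (simp add: ln_mono)
  also have "\<dots> = ln (norm \<Phi>) + ln (4 + 4 * k) + ln B"
    using k pos by (simp add: ln_mult_pos)
  finally have up: "ln N \<le> ln (norm \<Phi>) + ln (4 + 4 * k) + ln B" .
  have "norm \<Phi> * B \<le> norm \<Phi> * ((2 + 2 * k) * A)" by (intro mult_left_mono BA) auto
  also have "\<dots> = (2 + 2 * k) * (norm \<Phi> * A)" by simp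
  also have "\<dots> \<le> (2 + 2 * k) * (2 * N)" using k by (intro mult_left_mono N_ge) auto
  also have "\<dots> = (4 + 4 * k) * N" by simp
  finally have "ln (norm \<Phi> * B) \<le> ln ((4 + 4 * k) * N)"
    using pos by (intro ln_mono) auto
  then have "ln (norm \<Phi>) + ln B \<le> ln (4 + 4 * k) + ln N"
    using k pos N0 by (simp add: ln_mult_pos)
  with up show ?thesis unfolding N_def[symmetric] b_def[symmetric] B_def[symmetric] by linarith
qed

section \<open>The stability criteria\<close>

theorem corollary2p1:
  fixes t0 :: real
    and p p' q :: "real \<Rightarrow> complex"
    and D D' :: "real \<Rightarrow> real"
    and \<epsilon> c \<alpha> :: real
  assumes p_cont: "continuous_on {t0..} p"
    and q_cont: "continuous_on {t0..} q"
    and p_deriv: "\<And>t. t \<ge> t0 \<Longrightarrow> (p has_vector_derivative p' t) (at t within {t0..})"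
    and p'_cont: "continuous_on {t0..} p'"
    and D_eq: "\<And>t. t \<ge> t0 \<Longrightarrow> 2 * p' t + (p t)\<^sup>2 - 4 * q t = complex_of_real (D t)"
    and D_pos: "\<And>t. t \<ge> t0 \<Longrightarrow> D t > 0"
    and D_deriv: "\<And>t. t \<ge> t0 \<Longrightarrow> (D has_real_derivative D' t) (at t within {t0..})"
    and D'_cont: "continuous_on {t0..} D'"
    and \<epsilon>_pos: "\<epsilon> > 0" and c_pos: "c > 0" and \<alpha>_pos: "\<alpha> > 0"
    and D_ge: "\<And>t. t \<ge> t0 \<Longrightarrow> D t \<ge> \<epsilon>"
    and D'_le: "\<And>t. t \<ge> t0 \<Longrightarrow> \<bar>D' t\<bar> / D t \<le> c / (1 + t - t0) powr \<alpha>"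
    and D_int: "(\<lambda>\<tau>. 1 / (sqrt (D \<tau>) * (1 + \<tau> - t0) powr (2 * \<alpha>))) integrable_on {t0..}"
  shows
    "((\<forall>\<phi>. second_order_solution p q t0 \<phi> \<longrightarrow> bounded (\<phi> ` {t0..}))
        \<longleftrightarrow> bdd_above (r1 t0 p D ` {t0..})) \<and>
     ((\<forall>\<phi>. second_order_solution p q t0 \<phi> \<longrightarrow> (\<phi> \<longlongrightarrow> 0) at_top)
        \<longleftrightarrow> filterlim (r1 t0 p D) at_bot at_top) \<and>
     (liapunov_stable p q t0 \<longleftrightarrow> bdd_above (r2 t0 p D ` {t0..})) \<and>
     (asymptotically_stable p q t0 \<longleftrightarrow> filterlim (r2 t0 p D) at_bot at_top)"
proof -
  define s where "s t = sqrt (D t) / 2" for t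
  define s' where "s' t = D' t / (4 * sqrt (D t))" for t
  define h where "h \<tau> = 1 / (sqrt (D \<tau>) * (1 + \<tau> - t0) powr (2 * \<alpha>))" for \<tau>
  define S where "S t = integral {t0..t} s" for t
  define P where "P t = integral {t0..t} p" for t
  define J where "J t = c\<^sup>2 / 2 * integral {t0..t} h" for t
  define k where "k = c / 2"
  have D_cont: "continuous_on {t0..} D"
    by (rule DERIV_continuous_on[where D = D']) (auto intro: D_deriv)
  have s_cont: "continuous_on {t0..} s"
    unfolding s_def by (intro continuous_intros D_cont) auto
  have s_pos: "s t > 0" if "t \<ge> t0" for t using D_pos[OF that] by (simp add: s_def)
  have s_sq: "(s t)\<^sup>2 = D t / 4" if "t \<ge> t0" for t
    using D_pos[OF that] by (simp add: s_def power_divide)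
  have h_cont: "continuous_on {t0..} h"
    unfolding h_def using D_pos
    by (intro continuous_intros D_cont) (auto simp: less_imp_neq[symmetric])
  have S_deriv: "(S has_real_derivative s t) (at t within {t0..})" if "t \<ge> t0" for t
    unfolding S_def has_real_derivative_iff_has_vector_derivative
    by (rule integral_halfline_has_vector_derivative[OF s_cont that])
  have P_deriv: "(P has_vector_derivative p t) (at t within {t0..})" if "t \<ge> t0" for t
    unfolding P_def by (rule integral_halfline_has_vector_derivative[OF p_cont that])
  have J_deriv: "(J has_real_derivative c\<^sup>2 / 2 * h t) (at t within {t0..})" if "t \<ge> t0" for t
    unfolding J_def using integral_halfline_has_vector_derivative[OF h_cont that]
    by (intro DERIV_cmult) (simp add: has_real_derivative_iff_has_vector_derivative)
  have s_deriv: "(s has_real_derivative s' t) (at t within {t0..})" if "t \<ge> t0" for t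
    unfolding s_def s'_def using D_pos[OF that]
    by (auto intro!: derivative_eq_intros D_deriv that simp: field_simps)
  have s'_s: "s' t / s t = D' t / D t / 2" if "t \<ge> t0" for t
    using D_pos[OF that] by (simp add: s_def s'_def)
  have s'_le: "\<bar>s' t\<bar> \<le> k * s t" if t: "t \<ge> t0" for t
  proof -
    have "(1 + t - t0) powr \<alpha> \<ge> 1" using t \<alpha>_pos by (intro ge_one_powr_ge_zero) auto
    then have "c / (1 + t - t0) powr \<alpha> \<le> c" using c_pos by (simp add: divide_le_eq)
    with D'_le[OF t] have "\<bar>s' t / s t\<bar> \<le> k"
      unfolding s'_s[OF t] k_def using D_pos[OF t] by (simp add: abs_divide)
    then show ?thesis using s_pos[OF t] by (simp add: abs_divide divide_le_eq)
  qed
  have j: "(s' t / s t)\<^sup>2 / s t \<le> c\<^sup>2 / 2 * h t" if t: "t \<ge> t0" for t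
  proof -
    have "\<bar>D' t / D t\<bar>\<^sup>2 \<le> (c / (1 + t - t0) powr \<alpha>)\<^sup>2"
      using D'_le[OF t] D_pos[OF t] by (intro power_mono) (auto simp: abs_divide)
    also have "\<dots> = c\<^sup>2 / (1 + t - t0) powr (2 * \<alpha>)"
      using t by (simp add: power_divide powr_power mult.commute)
    finally have "(D' t / D t)\<^sup>2 / (2 * sqrt (D t))
        \<le> c\<^sup>2 / (1 + t - t0) powr (2 * \<alpha>) / (2 * sqrt (D t))"
      using D_pos[OF t] unfolding power2_abs by (intro divide_right_mono) auto
    then show ?thesis unfolding s'_s[OF t] by (simp add: s_def h_def power_divide mult_ac)
  qed
  have s2_cont: "continuous_on {t0..} (\<lambda>t. (s t)\<^sup>2)"
    by (intro continuous_intros s_cont)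
  obtain w z where w: "w t0 = 1" "z t0 = s t0"
    "\<And>t. t \<ge> t0 \<Longrightarrow> (w has_real_derivative z t) (at t within {t0..})"
    "\<And>t. t \<ge> t0 \<Longrightarrow> (z has_real_derivative (s t)\<^sup>2 * w t) (at t within {t0..})"
    by (rule second_order_real_solution_exists[OF s2_cont, of 1 "s t0"]) blast
  interpret growing_solution t0 s s' w z
    by unfold_locales (use w s_pos s_deriv in auto)
  interpret liouville_transformation t0 p p' q P "\<lambda>t. (s t)\<^sup>2" w z "s t0"
  proof
    fix t assume t: "t \<ge> t0"
    show "complex_of_real ((s t)\<^sup>2) = p' t / 2 + (p t)\<^sup>2 / 4 - q t"
      unfolding s_sq[OF t] using D_eq[OF t] by (simp add: field_simps)
  qed (use w p_deriv P_deriv w_z_lower s_pos in auto)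
  have \<Phi>0: "\<Phi> t \<noteq> 0" if "t \<ge> t0" for t using w_pos[OF that] by (simp add: \<Phi>_def E_def)
  have \<Psi>_eq: "\<Psi> t = \<Phi> t * (of_real (u t) - p t / 2)" if "t \<ge> t0" for t
    using w_pos[OF that] by (simp add: \<Psi>_def \<Phi>_def u_def field_simps)
  have u_near: "\<bar>u t - s t\<bar> \<le> k" if "t \<ge> t0" for t
    by (rule u_near_s[OF S_deriv s'_le that])
  \<comment> \<open>As \<open>ln \<bar>\<Phi>\<bar> = ln w - Re P / 2\<close> and \<open>ln s = ln D / 2 - ln 2\<close>, the amplitude estimate is a statement about \<open>r1 / 2\<close>.
      The first summand of \<open>M\<close> bounds the variation, the second the factor \<open>(u + s) / s\<close>, and the others are the
      initial value and the constant between \<open>ln s\<close> and \<open>ln D / 2\<close>.\<close>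
  define M where "M = c\<^sup>2 / 2 * integral {t0..} h + ln (2 + 2 * k / sqrt \<epsilon>)
    + \<bar>ln (s t0) / 2 + ln 2\<bar> + ln 2 / 2"
  have log1: "\<bar>ln (norm (\<Phi> t)) - r1 t0 p D t / 2\<bar> \<le> M" if t: "t \<ge> t0" for t
  proof -
    have J: "J t - J t0 \<le> c\<^sup>2 / 2 * integral {t0..} h"
    proof -
      have "integral {t0..t} h \<le> integral {t0..} h"
      proof (rule integral_subset_le)
        show "h integrable_on {t0..t}"
          by (intro integrable_continuous_real continuous_on_subset[OF h_cont]) auto
        show "h integrable_on {t0..}" using D_int by (simp add: h_def[abs_def])
        show "\<forall>x\<in>{t0..}. 0 \<le> h x" using D_pos by (simp add: h_def less_imp_le)
      qed auto
      then show ?thesis by (auto simp: J_def intro!: mult_left_mono)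
    qed
    have L: "0 \<le> ln ((u t + s t) / s t)" "ln ((u t + s t) / s t) \<le> ln (2 + 2 * k / sqrt \<epsilon>)"
    proof -
      have "1 \<le> (u t + s t) / s t" using u_pos[OF t] s_pos[OF t] by (simp add: le_divide_eq)
      then show "0 \<le> ln ((u t + s t) / s t)" by (rule ln_ge_zero)
      have k0: "k \<ge> 0" using c_pos by (simp add: k_def)
      have "(u t + s t) / s t \<le> (2 * s t + k) / s t"
        using u_near[OF t] s_pos[OF t] by (intro divide_right_mono) auto
      also have "\<dots> = 2 + k / s t" using s_pos[OF t] by (simp add: add_divide_distrib)
      also have "k / s t \<le> k / (sqrt \<epsilon> / 2)"
        using k0 \<epsilon>_pos D_ge[OF t] by (intro divide_left_mono) (auto simp: s_def)
      finally have "(u t + s t) / s t \<le> 2 + 2 * k / sqrt \<epsilon>" by (simp add: mult.commute)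
      then show "ln ((u t + s t) / s t) \<le> ln (2 + 2 * k / sqrt \<epsilon>)"
        using \<open>1 \<le> (u t + s t) / s t\<close> by (intro ln_mono) auto
    qed
    have "ln (norm (\<Phi> t)) = - Re (P t) / 2 + ln (w t)"
      using w_pos[OF t] by (simp add: \<Phi>_def E_def norm_mult ln_mult_pos)
    moreover have "r1 t0 p D t = 2 * S t - Re (P t) - ln (D t) / 2"
    proof -
      have i: "s integrable_on {t0..t}" "p integrable_on {t0..t}"
        by (auto intro!: integrable_continuous_real continuous_on_subset[OF s_cont]
            continuous_on_subset[OF p_cont])
      have ip: "(\<lambda>\<tau>. Re (p \<tau>)) integrable_on {t0..t}" "integral {t0..t} (\<lambda>\<tau>. Re (p \<tau>)) = Re (P t)"
        using integrable_linear[OF i(2) bounded_linear_Re] integral_linear[OF i(2) bounded_linear_Re]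
        by (simp_all add: o_def P_def)
      have "integral {t0..t} (\<lambda>\<tau>. 2 * s \<tau> - Re (p \<tau>)) = 2 * S t - Re (P t)"
        using integrable_on_cmult_left[OF i(1), of 2] ip
        by (simp add: Henstock_Kurzweil_Integration.integral_diff S_def)
      then show ?thesis by (simp add: r1_def s_def)
    qed
    moreover have "ln (D t) = 2 * (ln (s t) + ln 2)"
      using D_pos[OF t] by (simp add: s_def ln_div ln_sqrt)
    ultimately have "ln (norm (\<Phi> t)) - r1 t0 p D t / 2 = ln (w t) + ln (s t) / 2 - S t + ln 2 / 2"
      by (simp add: field_simps)
    moreover have "S t0 = 0" by (simp add: S_def)
    moreover have "ln 2 \<ge> (0::real)" by simp
    ultimately show ?thesis
      using log_amplitude[OF S_deriv _ J_deriv j t] J L unfolding M_def by linarith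
  qed
  have log2: "\<bar>ln (norm (\<Phi> t, \<Psi> t)) - r2 t0 p D t / 2\<bar> \<le> M + ln (4 + 4 * k)" if t: "t \<ge> t0" for t
  proof -
    have "\<bar>ln (norm (\<Phi> t, \<Psi> t)) - ln (norm (\<Phi> t)) - ln (1 + norm (p t - of_real (sqrt (D t))))\<bar>
        \<le> ln (4 + 4 * k)"
      using log_norm_solution_pair[OF \<Phi>0[OF t] u_near[OF t], of "p t"] by (simp add: \<Psi>_eq[OF t] s_def)
    moreover have "r2 t0 p D t / 2 = r1 t0 p D t / 2 + ln (1 + norm (p t - of_real (sqrt (D t))))"
      by (simp add: r2_def)
    ultimately show ?thesis using log1[OF t] by linarith
  qed
  have pair0: "(\<Phi> t, \<Psi> t) \<noteq> 0" if "t \<ge> t0" for t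
    using \<Phi>0[OF that] by (simp add: zero_prod_def)
  show ?thesis
    unfolding all_solutions_bounded_iff all_solutions_vanish_iff liapunov_stable_iff
      asymptotically_stable_iff
  proof (intro conjI)
    show "bounded (\<Phi> ` {t0..}) \<longleftrightarrow> bdd_above (r1 t0 p D ` {t0..})"
      by (rule bounded_iff_log_bdd_above[OF \<Phi>0 log1])
    show "(\<Phi> \<longlongrightarrow> 0) at_top \<longleftrightarrow> filterlim (r1 t0 p D) at_bot at_top"
      by (rule tendsto_0_iff_log_at_bot[OF \<Phi>0 log1])
    show "bounded ((\<lambda>t. (\<Phi> t, \<Psi> t)) ` {t0..}) \<longleftrightarrow> bdd_above (r2 t0 p D ` {t0..})"
      by (rule bounded_iff_log_bdd_above[OF pair0 log2])
    show "((\<lambda>t. (\<Phi> t, \<Psi> t)) \<longlongrightarrow> 0) at_top \<longleftrightarrow> filterlim (r2 t0 p D) at_bot at_top"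
      by (rule tendsto_0_iff_log_at_bot[OF pair0 log2])
  qed
qed

end
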